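(* Let $n$ be a positive integer, let $g_1,\dots,g_n\in A^2(\mathbb{D})$, and let $A$ be the finite rank operator on $A^2(\mathbb{D})$ given by $A(f)=\sum_{i=1}^{n}\langle f,g_i\rangle g_i$ for $f\in A^2(\mathbb{D})$. Then the Berezin range $\mathrm{Ber}(A)$ is convex in $\mathbb{C}$.
   Context: $\mathbb{D}$ is the open unit disc in $\mathbb{C}$. $A^2(\mathbb{D})$ is the Bergman space of holomorphic functions $f$ on $\mathbb{D}$ with $\int_{\mathbb{D}}|f(z)|^2\,dV(z)<\infty$, where $dV$ is the normalized area measure on $\mathbb{D}$, with inner product $\langle f,g\rangle=\int_{\mathbb{D}}f(z)\overline{g(z)}\,dV(z)$. It is a reproducing kernel Hilbert space with reproducing kernel $k_\lambda(z)=\frac{1}{(1-\bar\lambda z)^2}$ at $\lambda\in\mathbb{D}$, and $\hat{k}_\lambda=k_\lambda/\|k_\lambda\|$ is the normalized reproducing kernel. For a bounded linear operator $T$ on $A^2(\mathbb{D})$, the Berezin transform is $\widetilde{T}(\lambda)=\langle T\hat{k}_\lambda,\hat{k}_\lambda\rangle$ for $\lambda\in\mathbb{D}$, and the Berezin range is $\mathrm{Ber}(T)=\{\widetilde{T}(\lambda):\lambda\in\mathbb{D}\}$. *)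

theory Defs
  imports "HOL-Complex_Analysis.Complex_Analysis"
begin

abbreviation unit_disc :: "complex set" where
  "unit_disc \<equiv> ball 0 1"

(* The underlying space is the disc itself, so that functions need to be measurable there only. *)
definition disc_area :: "complex measure" where
  "disc_area = uniform_measure (restrict_space lborel unit_disc) unit_disc"

(* Elements are represented by total functions; only their values on the disc matter, and two
   functions agreeing on the disc represent the same element. *)
definition bergman_space :: "(complex \<Rightarrow> complex) set" where
  "bergman_space =
     {f. f holomorphic_on unit_disc \<and> integrable disc_area (\<lambda>z. (cmod (f z))\<^sup>2)}"

definition bergman_inner :: "(complex \<Rightarrow> complex) \<Rightarrow> (complex \<Rightarrow> complex) \<Rightarrow> complex" where
  "bergman_inner f g = (\<integral>z. f z * cnj (g z) \<partial>disc_area)"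

definition bergman_norm :: "(complex \<Rightarrow> complex) \<Rightarrow> real" where
  "bergman_norm f = sqrt (Re (bergman_inner f f))"

definition bergman_kernel :: "complex \<Rightarrow> complex \<Rightarrow> complex" where
  "bergman_kernel l z = 1 / (1 - cnj l * z)\<^sup>2"

definition normalized_kernel :: "complex \<Rightarrow> complex \<Rightarrow> complex" where
  "normalized_kernel l z = bergman_kernel l z / of_real (bergman_norm (bergman_kernel l))"

definition berezin_transform ::
    "((complex \<Rightarrow> complex) \<Rightarrow> (complex \<Rightarrow> complex)) \<Rightarrow> complex \<Rightarrow> complex" where
  "berezin_transform T l = bergman_inner (T (normalized_kernel l)) (normalized_kernel l)"

definition berezin_range ::
    "((complex \<Rightarrow> complex) \<Rightarrow> (complex \<Rightarrow> complex)) \<Rightarrow> complex set" where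
  "berezin_range T = berezin_transform T ` unit_disc"

end

theory Submission
  imports Defs "HOL-Probability.Probability_Measure"
begin

text \<open>
  Expanding \<^term>\<open>A\<close> by linearity and using that the Bergman inner product is conjugate symmetric,
  the Berezin transform at \<open>\<lambda>\<close> is \<open>\<Sum>\<^sub>i |\<langle>g\<^sub>i, k\<^sub>\<lambda>\<rangle>|\<^sup>2 / \<parallel>k\<^sub>\<lambda>\<parallel>\<^sup>2\<close>, a real number. It depends continuously on
  \<open>\<lambda>\<close> (\<open>continuous_on_bergman_inner_kernel\<close>, \<open>continuous_on_bergman_norm_kernel\<close>), so the Berezin
  range is the image of the connected disc under a continuous real-valued function, that is, an
  interval of the real axis.

  Continuity comes from dominated convergence. The kernel satisfies
  \<open>|k\<^sub>\<lambda>(z)| \<le> 1 / (1 - |\<lambda>|)\<^sup>2\<close> for all \<open>z\<close> in the disc, which is locally bounded in \<open>\<lambda>\<close>, and members of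
  the Bergman space are integrable because the area measure is finite. Division by \<open>\<parallel>k\<^sub>\<lambda>\<parallel>\<close> is harmless
  since \<open>|k\<^sub>\<lambda>| \<ge> 1/4\<close> on the disc.
\<close>

section \<open>The normalized area measure\<close>

lemma space_disc_area [simp]: "space disc_area = unit_disc"
  by (simp add: disc_area_def space_restrict_space)

lemma prob_space_disc_area: "prob_space disc_area"
proof -
  have "emeasure (restrict_space lborel unit_disc) unit_disc = emeasure lborel unit_disc"
    by (subst emeasure_restrict_space) auto
  also have "\<dots> = ennreal pi"
    by (simp add: emeasure_ball unit_ball_vol_2)
  finally show ?thesis
    unfolding disc_area_def by (intro prob_space_uniform_measure) simp_all
qed

interpretation disc_area: prob_space disc_area
  by (rule prob_space_disc_area)

lemma borel_measurable_disc_area: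
  assumes "continuous_on unit_disc f"
  shows "f \<in> borel_measurable disc_area"
proof -
  have sets_eq: "sets disc_area = sets (restrict_space borel unit_disc)"
    by (simp add: disc_area_def sets_restrict_space)
  show ?thesis
    unfolding measurable_cong_sets[OF sets_eq refl]
    by (rule borel_measurable_continuous_on_restrict[OF assms])
qed

section \<open>Continuity of parameter integrals\<close>

text \<open>Convergent sequences \<open>B (\<lambda>\<^sub>n)\<close> are bounded, so a pointwise bound that is continuous in the
  parameter suffices for dominated convergence along sequences.\<close>

lemma continuous_on_integral_mult_bounded:
  fixes g :: "'a \<Rightarrow> 'b :: {second_countable_topology, banach, real_normed_algebra}"
    and F :: "'c :: metric_space \<Rightarrow> 'a \<Rightarrow> 'b"
  assumes g: "integrable M g"
    and meas: "\<And>l. l \<in> S \<Longrightarrow> F l \<in> borel_measurable M"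
    and cont: "\<And>z. z \<in> space M \<Longrightarrow> continuous_on S (\<lambda>l. F l z)"
    and bound: "\<And>l z. l \<in> S \<Longrightarrow> z \<in> space M \<Longrightarrow> norm (F l z) \<le> B l"
    and B: "continuous_on S B"
  shows "continuous_on S (\<lambda>l. \<integral>z. g z * F l z \<partial>M)"
  unfolding continuous_on_sequentially
proof (intro allI ballI impI)
  fix u a
  assume a: "a \<in> S" and "(\<forall>n. u n \<in> S) \<and> u \<longlonglongrightarrow> a"
  then have u: "\<And>n. u n \<in> S" and lim: "u \<longlonglongrightarrow> a" by auto
  have "(\<lambda>n. B (u n)) \<longlonglongrightarrow> B a"
    using B a u lim unfolding continuous_on_sequentially comp_def by blast
  then have "Bseq (\<lambda>n. B (u n))"
    by (intro convergent_imp_Bseq convergentI)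
  then obtain C where C: "\<And>n. norm (B (u n)) \<le> C"
    unfolding Bseq_def by blast
  have "(\<lambda>n. \<integral>z. g z * F (u n) z \<partial>M) \<longlonglongrightarrow> (\<integral>z. g z * F a z \<partial>M)"
  proof (rule integral_dominated_convergence[where w = "\<lambda>z. norm (g z) * C"])
    show "AE z in M. (\<lambda>n. g z * F (u n) z) \<longlonglongrightarrow> g z * F a z"
    proof (rule AE_I2)
      fix z assume "z \<in> space M"
      then have "(\<lambda>n. F (u n) z) \<longlonglongrightarrow> F a z"
        using cont a u lim unfolding continuous_on_sequentially comp_def by blast
      then show "(\<lambda>n. g z * F (u n) z) \<longlonglongrightarrow> g z * F a z"
        by (intro tendsto_mult tendsto_const)
    qed
    show "AE z in M. norm (g z * F (u n) z) \<le> norm (g z) * C" for n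
    proof (rule AE_I2)
      fix z assume "z \<in> space M"
      then have "norm (F (u n) z) \<le> C"
        using bound[OF u, of z n] C[of n] by simp
      then show "norm (g z * F (u n) z) \<le> norm (g z) * C"
        by (intro order_trans[OF norm_mult_ineq] mult_left_mono norm_ge_zero)
    qed
    show "integrable M (\<lambda>z. norm (g z) * C)"
      by (intro integrable_mult_left integrable_norm g)
  qed (intro borel_measurable_times borel_measurable_integrable[OF g] meas a u)+
  then show "((\<lambda>l. \<integral>z. g z * F l z \<partial>M) \<circ> u) \<longlonglongrightarrow> (\<integral>z. g z * F a z \<partial>M)"
    by (simp add: comp_def)
qed

section \<open>The Bergman kernel\<close>

lemma norm_mult_disc_less_1:
  assumes "l \<in> unit_disc" "z \<in> unit_disc"
  shows "cmod (cnj l * z) < 1"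
  using assms mult_strict_mono'[of "cmod l" 1 "cmod z" 1] by (simp add: norm_mult)

lemma bergman_kernel_denom_nonzero:
  assumes "l \<in> unit_disc" "z \<in> unit_disc"
  shows "1 - cnj l * z \<noteq> 0"
  using norm_mult_disc_less_1[OF assms] by auto

text \<open>Since \<open>|1 - cnj \<lambda> z| \<ge> 1 - |\<lambda>|\<close> for \<open>|z| < 1\<close>, the kernel has a bound that is uniform in \<open>z\<close> and
  continuous in \<open>\<lambda>\<close>; it is the dominating function in every continuity argument below.\<close>

lemma bergman_kernel_bound:
  assumes "l \<in> unit_disc" "z \<in> unit_disc"
  shows "cmod (bergman_kernel l z) \<le> 1 / (1 - cmod l)\<^sup>2"
proof -
  have "cmod (cnj l * z) \<le> cmod l"
    using assms by (simp add: norm_mult mult_left_le)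
  then have "1 - cmod l \<le> cmod (1 - cnj l * z)"
    using norm_triangle_ineq2[of 1 "cnj l * z"] by simp
  then have "(1 - cmod l)\<^sup>2 \<le> (cmod (1 - cnj l * z))\<^sup>2"
    using assms by (intro power_mono) auto
  moreover have "0 < (1 - cmod l)\<^sup>2"
    using assms by auto
  ultimately show ?thesis
    by (simp add: bergman_kernel_def norm_divide norm_power frac_le)
qed

text \<open>This bound keeps \<open>\<parallel>k\<^sub>\<lambda>\<parallel>\<close> away from zero, so that normalizing the kernel is legitimate.\<close>

lemma bergman_kernel_lower_bound:
  assumes "l \<in> unit_disc" "z \<in> unit_disc"
  shows "1 / 4 \<le> cmod (bergman_kernel l z)"
proof -
  have "cmod (1 - cnj l * z) \<le> 2"
    using norm_triangle_ineq4[of 1 "cnj l * z"] norm_mult_disc_less_1[OF assms] by simp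
  then have "(cmod (1 - cnj l * z))\<^sup>2 \<le> 2\<^sup>2"
    by (intro power_mono) auto
  then show ?thesis
    using bergman_kernel_denom_nonzero[OF assms]
    by (simp add: bergman_kernel_def norm_divide norm_power frac_le)
qed

lemma holomorphic_bergman_kernel:
  assumes "l \<in> unit_disc"
  shows "bergman_kernel l holomorphic_on unit_disc"
  unfolding bergman_kernel_def
  using bergman_kernel_denom_nonzero[OF assms] by (intro holomorphic_intros) auto

lemma continuous_on_bergman_kernel_parameter:
  assumes "z \<in> unit_disc"
  shows "continuous_on unit_disc (\<lambda>l. bergman_kernel l z)"
  unfolding bergman_kernel_def
  using bergman_kernel_denom_nonzero[OF _ assms] by (intro continuous_intros) auto

lemma borel_measurable_bergman_kernel:
  assumes "l \<in> unit_disc"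
  shows "bergman_kernel l \<in> borel_measurable disc_area"
  by (intro borel_measurable_disc_area holomorphic_on_imp_continuous_on
      holomorphic_bergman_kernel assms)

lemma continuous_on_bergman_kernel_bound:
  "continuous_on unit_disc (\<lambda>l. 1 / (1 - cmod l)\<^sup>2)"
  by (intro continuous_intros) auto

section \<open>Inner products and norms in the Bergman space\<close>

text \<open>A square-integrable function on a space of finite measure is integrable, since
  \<open>|f| \<le> 1 + |f|\<^sup>2\<close>.\<close>

lemma integrable_bergman_space:
  assumes "f \<in> bergman_space"
  shows "integrable disc_area f"
proof (rule Bochner_Integration.integrable_bound)
  show "integrable disc_area (\<lambda>z. 1 + (cmod (f z))\<^sup>2)"
    using assms by (auto simp: bergman_space_def)
  show "f \<in> borel_measurable disc_area"
    using assms
    by (auto simp: bergman_space_def intro!: borel_measurable_disc_area holomorphic_on_imp_continuous_on)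
  have "x \<le> 1 + x\<^sup>2" for x :: real
    using sum_power2_ge_zero[of "x - 1" x] by (simp add: power2_eq_square algebra_simps)
  then show "AE z in disc_area. norm (f z) \<le> norm (1 + (cmod (f z))\<^sup>2)"
    by simp
qed

lemma integrable_bergman_space_mult_kernel:
  assumes "f \<in> bergman_space" "l \<in> unit_disc"
  shows "integrable disc_area (\<lambda>z. f z * cnj (bergman_kernel l z))"
proof (rule Bochner_Integration.integrable_bound)
  note f = integrable_bergman_space[OF assms(1)]
  show "integrable disc_area (\<lambda>z. norm (f z) * (1 / (1 - cmod l)\<^sup>2))"
    using f by auto
  show "(\<lambda>z. f z * cnj (bergman_kernel l z)) \<in> borel_measurable disc_area"
    using f assms(2)
    by (intro borel_measurable_times borel_measurable_integrable borel_measurable_disc_area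
        continuous_on_cnj holomorphic_on_imp_continuous_on holomorphic_bergman_kernel)
  show "AE z in disc_area. norm (f z * cnj (bergman_kernel l z))
          \<le> norm (norm (f z) * (1 / (1 - cmod l)\<^sup>2))"
  proof (rule AE_I2)
    fix z assume "z \<in> space disc_area"
    then have "norm (f z) * cmod (bergman_kernel l z) \<le> norm (f z) * (1 / (1 - cmod l)\<^sup>2)"
      using bergman_kernel_bound[OF assms(2)] by (intro mult_left_mono) auto
    then show "norm (f z * cnj (bergman_kernel l z)) \<le> norm (norm (f z) * (1 / (1 - cmod l)\<^sup>2))"
      by (simp add: norm_mult)
  qed
qed

lemma integrable_norm_bergman_kernel_squared:
  assumes "l \<in> unit_disc"
  shows "integrable disc_area (\<lambda>z. (cmod (bergman_kernel l z))\<^sup>2)"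
proof (rule disc_area.integrable_const_bound[where B = "(1 / (1 - cmod l)\<^sup>2)\<^sup>2"])
  show "AE z in disc_area. norm ((cmod (bergman_kernel l z))\<^sup>2) \<le> (1 / (1 - cmod l)\<^sup>2)\<^sup>2"
  proof (rule AE_I2)
    fix z assume "z \<in> space disc_area"
    then show "norm ((cmod (bergman_kernel l z))\<^sup>2) \<le> (1 / (1 - cmod l)\<^sup>2)\<^sup>2"
      using power_mono[OF bergman_kernel_bound[OF assms], of z 2] by simp
  qed
  show "(\<lambda>z. (cmod (bergman_kernel l z))\<^sup>2) \<in> borel_measurable disc_area"
    using borel_measurable_bergman_kernel[OF assms] by measurable
qed

lemma bergman_norm_eq: "bergman_norm f = sqrt (\<integral>z. (cmod (f z))\<^sup>2 \<partial>disc_area)"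
proof -
  have "bergman_inner f f = (\<integral>z. complex_of_real ((cmod (f z))\<^sup>2) \<partial>disc_area)"
    unfolding bergman_inner_def by (intro Bochner_Integration.integral_cong refl complex_norm_square[symmetric])
  also have "\<dots> = complex_of_real (\<integral>z. (cmod (f z))\<^sup>2 \<partial>disc_area)"
    by (rule integral_complex_of_real)
  finally show ?thesis
    by (simp add: bergman_norm_def)
qed

lemma bergman_norm_kernel_pos:
  assumes "l \<in> unit_disc"
  shows "0 < bergman_norm (bergman_kernel l)"
proof -
  have "1 / 16 \<le> (\<integral>z. (cmod (bergman_kernel l z))\<^sup>2 \<partial>disc_area)"
  proof (rule disc_area.integral_ge_const)
    show "AE z in disc_area. 1 / 16 \<le> (cmod (bergman_kernel l z))\<^sup>2"
    proof (rule AE_I2)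
      fix z assume "z \<in> space disc_area"
      then show "1 / 16 \<le> (cmod (bergman_kernel l z))\<^sup>2"
        using power_mono[OF bergman_kernel_lower_bound[OF assms], of z 2]
        by (simp add: power2_eq_square)
    qed
  qed (rule integrable_norm_bergman_kernel_squared[OF assms])
  then show ?thesis
    by (simp add: bergman_norm_eq)
qed

lemma continuous_on_bergman_inner_kernel:
  assumes "f \<in> bergman_space"
  shows "continuous_on unit_disc (\<lambda>l. bergman_inner f (bergman_kernel l))"
  unfolding bergman_inner_def
proof (rule continuous_on_integral_mult_bounded[OF integrable_bergman_space[OF assms] _ _ _
      continuous_on_bergman_kernel_bound])
  show "(\<lambda>z. cnj (bergman_kernel l z)) \<in> borel_measurable disc_area" if "l \<in> unit_disc" for l
    using that by (intro borel_measurable_disc_area continuous_on_cnj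
      holomorphic_on_imp_continuous_on holomorphic_bergman_kernel)
qed (auto intro!: continuous_on_cnj continuous_on_bergman_kernel_parameter
      simp del: mem_ball_0 simp add: bergman_kernel_bound)

lemma continuous_on_bergman_norm_kernel:
  "continuous_on unit_disc (\<lambda>l. bergman_norm (bergman_kernel l))"
proof -
  have "continuous_on unit_disc (\<lambda>l. \<integral>z. 1 * (cmod (bergman_kernel l z))\<^sup>2 \<partial>disc_area)"
  proof (rule continuous_on_integral_mult_bounded)
    show "continuous_on unit_disc (\<lambda>l. (1 / (1 - cmod l)\<^sup>2)\<^sup>2)"
      by (intro continuous_on_power continuous_on_bergman_kernel_bound)
    show "norm ((cmod (bergman_kernel l z))\<^sup>2) \<le> (1 / (1 - cmod l)\<^sup>2)\<^sup>2"
      if "l \<in> unit_disc" "z \<in> space disc_area" for l z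
      using that power_mono[OF bergman_kernel_bound, of l z 2] by simp
    show "continuous_on unit_disc (\<lambda>l. (cmod (bergman_kernel l z))\<^sup>2)" if "z \<in> space disc_area" for z
      using that by (intro continuous_on_power continuous_on_norm
        continuous_on_bergman_kernel_parameter) simp
    show "(\<lambda>z. (cmod (bergman_kernel l z))\<^sup>2) \<in> borel_measurable disc_area" if "l \<in> unit_disc" for l
      using borel_measurable_bergman_kernel[OF that] by measurable
  qed simp
  then show ?thesis
    unfolding bergman_norm_eq by (simp add: continuous_on_real_sqrt)
qed

lemma bergman_inner_commute: "bergman_inner f g = cnj (bergman_inner g f)"
proof -
  have "cnj (bergman_inner g f) = (\<integral>z. cnj (g z * cnj (f z)) \<partial>disc_area)"
    unfolding bergman_inner_def by (rule Bochner_Integration.integral_cnj[symmetric])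
  then show ?thesis
    by (simp only: bergman_inner_def complex_cnj_mult complex_cnj_cnj mult.commute)
qed

lemma bergman_inner_normalized_kernel:
  "bergman_inner f (normalized_kernel l)
     = bergman_inner f (bergman_kernel l) / of_real (bergman_norm (bergman_kernel l))"
  by (simp add: bergman_inner_def normalized_kernel_def)

lemma normalized_kernel_in_bergman_space:
  assumes "l \<in> unit_disc"
  shows "normalized_kernel l \<in> bergman_space"
proof -
  have "normalized_kernel l holomorphic_on unit_disc"
    unfolding normalized_kernel_def using bergman_norm_kernel_pos[OF assms]
    by (intro holomorphic_intros holomorphic_bergman_kernel assms) auto
  moreover have "integrable disc_area (\<lambda>z. (cmod (normalized_kernel l z))\<^sup>2)"
    using integrable_norm_bergman_kernel_squared[OF assms]
    by (simp add: normalized_kernel_def norm_divide power_divide)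
  ultimately show ?thesis
    by (simp add: bergman_space_def)
qed

section \<open>The Berezin transform of the finite rank operator\<close>

text \<open>Each summand of the transform is \<open>\<langle>k, g\<^sub>i\<rangle> \<langle>g\<^sub>i, k\<rangle>\<close> for the normalized kernel \<open>k\<close>, a product of
  conjugate numbers; this is where it matters that the same \<open>g\<^sub>i\<close> occurs in both slots of the
  operator.\<close>

lemma berezin_transform_finite_rank:
  assumes g: "\<And>i. i \<in> I \<Longrightarrow> g i \<in> bergman_space"
    and A: "\<And>f z. f \<in> bergman_space \<Longrightarrow> z \<in> unit_disc \<Longrightarrow>
              A f z = (\<Sum>i\<in>I. bergman_inner f (g i) * g i z)"
    and l: "l \<in> unit_disc"
  shows "berezin_transform A l =
    of_real (\<Sum>i\<in>I. (cmod (bergman_inner (g i) (bergman_kernel l))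
                      / bergman_norm (bergman_kernel l))\<^sup>2)"
proof -
  let ?k = "normalized_kernel l"
  have int: "integrable disc_area (\<lambda>z. g i z * cnj (?k z))" if "i \<in> I" for i
    using integrable_bergman_space_mult_kernel[OF g[OF that] l] by (simp add: normalized_kernel_def)
  have "berezin_transform A l = (\<integral>z. (\<Sum>i\<in>I. bergman_inner ?k (g i) * (g i z * cnj (?k z))) \<partial>disc_area)"
    unfolding berezin_transform_def bergman_inner_def[of "A ?k"]
    by (intro Bochner_Integration.integral_cong refl)
      (simp add: A[OF normalized_kernel_in_bergman_space[OF l]] sum_distrib_right mult.assoc)
  also have "\<dots> = (\<Sum>i\<in>I. \<integral>z. bergman_inner ?k (g i) * (g i z * cnj (?k z)) \<partial>disc_area)"
    by (intro Bochner_Integration.integral_sum integrable_mult_right int)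
  also have "\<dots> = (\<Sum>i\<in>I. bergman_inner ?k (g i) * bergman_inner (g i) ?k)"
    by (simp add: bergman_inner_def[of "g _" ?k])
  also have "\<dots> = (\<Sum>i\<in>I. of_real ((cmod (bergman_inner (g i) ?k))\<^sup>2))"
    by (intro sum.cong refl)
      (simp only: bergman_inner_commute[of ?k] complex_norm_square mult.commute)
  finally show ?thesis
    using bergman_norm_kernel_pos[OF l] by (simp add: bergman_inner_normalized_kernel norm_divide)
qed

theorem theorem3p5:
  fixes n :: nat
    and g :: "nat \<Rightarrow> complex \<Rightarrow> complex"
    and A :: "(complex \<Rightarrow> complex) \<Rightarrow> (complex \<Rightarrow> complex)"
  assumes "n \<ge> 1"
    and "\<And>i. i \<in> {1..n} \<Longrightarrow> g i \<in> bergman_space"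
    and "\<And>f z. f \<in> bergman_space \<Longrightarrow> z \<in> unit_disc \<Longrightarrow>
           A f z = (\<Sum>i=1..n. bergman_inner f (g i) * g i z)"
  shows "convex (berezin_range A)"
proof -
  define h where "h = (\<lambda>l. \<Sum>i=1..n. (cmod (bergman_inner (g i) (bergman_kernel l))
                                      / bergman_norm (bergman_kernel l))\<^sup>2)"
  have "bergman_norm (bergman_kernel l) \<noteq> 0" if "l \<in> unit_disc" for l
    using bergman_norm_kernel_pos[OF that] by simp
  then have "continuous_on unit_disc h"
    unfolding h_def
    by (intro continuous_intros continuous_on_bergman_inner_kernel
        continuous_on_bergman_norm_kernel assms(2)) auto
  then have "convex (h ` unit_disc)"
    using connected_continuous_image connected_ball is_interval_connected_1 is_interval_convex_1
    by metis
  then have "convex (complex_of_real ` h ` unit_disc)"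
    by (rule convex_linear_image[OF bounded_linear.linear[OF bounded_linear_of_real]])
  moreover have "berezin_range A = complex_of_real ` h ` unit_disc"
    unfolding berezin_range_def image_image h_def
    by (intro image_cong refl berezin_transform_finite_rank assms(2,3))
  ultimately show ?thesis
    by simp
qed

end
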